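(* Let $d\ge3$ and consider the graph $(b,0)$ over $X=\mathbb Z^d$ with standard weights, i.e. $b(x,y)=1$ if $x$ and $y$ have Euclidean distance one and $b(x,y)=0$ otherwise. Then the Royden compactification of $\mathbb Z^d$ is the one-point compactification of (the discrete space) $\mathbb Z^d$.
   Context: For $f:X\to\mathbb R$ put $\widetilde Q(f)=\frac12\sum_{x,y\in X}b(x,y)|f(x)-f(y)|^2\in[0,\infty]$ and $\widetilde D=\{f:X\to\mathbb R:\widetilde Q(f)<\infty\}$; $\ell^\infty(X)$ denotes the bounded real-valued functions on $X$. The Royden compactification $R$ of the graph is the unique (up to homeomorphism) compact Hausdorff space such that $X$ (discrete) is a dense open subset of $R$, each function in the algebra $\widetilde D\cap\ell^\infty(X)$ extends uniquely to a continuous function on $R$, and (the extensions of) $\widetilde D\cap\ell^\infty(X)$ separate the points of $R$. *)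

theory Defs
  imports "HOL-Analysis.Analysis"
begin

text \<open>
  A graph \<open>(b,0)\<close> over the discrete vertex set \<open>X\<close> is given by its edge weight
  \<open>b \<ge> 0\<close> on a vertex type \<open>'x\<close> (all of the type is \<open>X\<close>).
\<close>

definition energy :: "('x \<Rightarrow> 'x \<Rightarrow> real) \<Rightarrow> ('x \<Rightarrow> real) \<Rightarrow> ennreal" where
  "energy b f = (1 / 2) * (\<Sum>\<^sub>\<infinity>(x, y)\<in>UNIV. ennreal (b x y * \<bar>f x - f y\<bar>\<^sup>2))"

definition finite_energy :: "('x \<Rightarrow> 'x \<Rightarrow> real) \<Rightarrow> ('x \<Rightarrow> real) set" where
  "finite_energy b = {f. energy b f < \<infinity>}"

definition royden_algebra :: "('x \<Rightarrow> 'x \<Rightarrow> real) \<Rightarrow> ('x \<Rightarrow> real) set" where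
  "royden_algebra b = finite_energy b \<inter> {f. bounded (range f)}"

text \<open>
  The inclusion of \<open>X\<close> into a compactification \<open>R\<close> is an explicit map \<open>\<iota>\<close>. Functions on
  \<open>topspace R\<close> are normalised by \<open>extensional\<close>, so that unique existence concerns only their
  values on \<open>R\<close>.
\<close>

definition continuous_extensions ::
    "'r topology \<Rightarrow> ('x \<Rightarrow> 'r) \<Rightarrow> ('x \<Rightarrow> real) \<Rightarrow> ('r \<Rightarrow> real) set" where
  "continuous_extensions R \<iota> f =
     {F \<in> extensional (topspace R).
        continuous_map R euclideanreal F \<and> (\<forall>x. F (\<iota> x) = f x)}"

definition royden_compactification ::
    "('x \<Rightarrow> 'x \<Rightarrow> real) \<Rightarrow> 'r topology \<Rightarrow> ('x \<Rightarrow> 'r) \<Rightarrow> bool" where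
  "royden_compactification b R \<iota> \<longleftrightarrow>
     compact_space R \<and> Hausdorff_space R \<and>
     embedding_map (discrete_topology UNIV) R \<iota> \<and>
     openin R (range \<iota>) \<and> R closure_of (range \<iota>) = topspace R \<and>
     (\<forall>f \<in> royden_algebra b. \<exists>!F. F \<in> continuous_extensions R \<iota> f) \<and>
     (\<forall>p \<in> topspace R. \<forall>q \<in> topspace R. p \<noteq> q \<longrightarrow>
        (\<exists>f \<in> royden_algebra b. \<exists>F \<in> continuous_extensions R \<iota> f. F p \<noteq> F q))"

definition lattice_point :: "int ^ 'd \<Rightarrow> real ^ 'd" where
  "lattice_point x = (\<chi> i. real_of_int (x $ i))"

definition standard_weights :: "int ^ 'd \<Rightarrow> int ^ 'd \<Rightarrow> real" where
  "standard_weights x y = (if dist (lattice_point x) (lattice_point y) = 1 then 1 else 0)"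

end

(*
  Every f of finite energy on Z^d, d >= 3, converges at infinity. Let A_N(x) be the mean of f over
  the cube x + [0, N)^d. By Cauchy-Schwarz A_N changes by at most sqrt(K) N^(-d/2) along an edge,
  where K bounds the square sums of the gradient of f. Comparing A_N and A_M, M = 4 N, with
  their common iterated mean gives |A_N - A_M| = O(N^(1 - d/2)), summable along N = 4^n, so that
  A_N converges uniformly in x; the limit L does not depend on x. For fixed N, A_N - f vanishes at
  infinity because the gradient of f does. Hence f tends to L.

  Consequently the functions in the Royden algebra take the same value at all points of R outside
  Z^d; as they separate points, there is at most one such point, and there is one since Z^d is not compact.
*)
theory Submission
  imports Defs
begin

subsection \<open>Compactifications on which every function has a limit at infinity\<close>

text \<open>Compact subsets of a discrete space are finite, so the neighbourhoods of
  \<open>None\<close> are the cofinite sets containing it. Continuity at \<open>None\<close> is thus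
  convergence along \<open>cofinite\<close>; at the isolated points nothing has to be
  checked.\<close>

lemma cofinite_limit_imp_continuous_map_Alexandroff:
  fixes f :: "'x \<Rightarrow> real"
  assumes "(f \<longlongrightarrow> L) cofinite"
  shows "continuous_map (Alexandroff_compactification (discrete_topology UNIV)) euclideanreal
           (case_option L f)"
  unfolding continuous_map_def
proof (intro conjI strip)
  let ?A = "Alexandroff_compactification (discrete_topology (UNIV :: 'x set))"
  fix U :: "real set"
  assume "openin euclideanreal U"
  then have U: "open U" by simp
  have top: "topspace ?A = UNIV"
    by (auto simp: notin_range_Some)
  show "openin ?A {z \<in> topspace ?A. case_option L f z \<in> U}"
  proof (cases "L \<in> U")
    case True
    then have "finite {x. f x \<notin> U}"
      using assms U topological_tendstoD eventually_cofinite by metis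
    moreover have "{z \<in> topspace ?A. case_option L f z \<in> U} = insert None (Some ` (UNIV - {x. f x \<notin> U}))" (is "?l = ?r")
    proof (rule set_eqI)
      show "z \<in> ?l \<longleftrightarrow> z \<in> ?r" for z
        using True unfolding top by (cases z) auto
    qed
    ultimately show ?thesis
      unfolding openin_Alexandroff_compactification
      by (intro disjI2 exI[of _ "{x. f x \<notin> U}"]) (simp add: compactin_discrete_topology)
  next
    case False
    then have "{z \<in> topspace ?A. case_option L f z \<in> U} = Some ` {x. f x \<in> U}" (is "?l = ?r")
    proof (intro set_eqI)
      show "z \<in> ?l \<longleftrightarrow> z \<in> ?r" for z
        using False unfolding top by (cases z) auto
    qed
    then show ?thesis by simp
  qed
qed auto

lemma Hausdorff_space_Alexandroff_discrete:
  "Hausdorff_space (Alexandroff_compactification (discrete_topology S))"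
  by (simp add: Hausdorff_space_Alexandroff_compactification
      locally_compact_space_discrete_topology)

text \<open>Limits at infinity provide the extensions, and density of the vertices makes them
  unique; density holds because the vertex set is infinite. Of two distinct points at least one is a
  vertex, and its indicator separates them.\<close>

lemma royden_compactification_Alexandroff:
  fixes b :: "'x \<Rightarrow> 'x \<Rightarrow> real"
  assumes inf: "infinite (UNIV :: 'x set)"
    and ind: "\<And>x. indicator {x} \<in> royden_algebra b"
    and lim: "\<And>f. f \<in> royden_algebra b \<Longrightarrow> \<exists>L. (f \<longlongrightarrow> L) cofinite"
  shows "royden_compactification b (Alexandroff_compactification (discrete_topology UNIV)) Some"
proof -
  let ?A = "Alexandroff_compactification (discrete_topology (UNIV :: 'x set))"
  have top: "topspace ?A = UNIV"
    by (auto simp: notin_range_Some)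
  have dense: "?A closure_of range Some = topspace ?A"
    using Alexandroff_compactification_dense[of "discrete_topology (UNIV :: 'x set)"] inf
    by (simp add: compact_space_discrete_topology)
  have ex: "case_option L f \<in> continuous_extensions ?A Some f" if "(f \<longlongrightarrow> L) cofinite" for f L
    using cofinite_limit_imp_continuous_map_Alexandroff[OF that]
    unfolding continuous_extensions_def top by simp
  have uniq: "F = G" if "F \<in> continuous_extensions ?A Some f" "G \<in> continuous_extensions ?A Some f"
    for f F G
  proof
    fix z
    show "F z = G z"
      by (rule forall_in_closure_of_eq[of z ?A "range Some" euclideanreal])
         (use that dense top in \<open>auto simp: continuous_extensions_def\<close>)
  qed
  have sep_Some: "\<exists>f \<in> royden_algebra b. \<exists>F \<in> continuous_extensions ?A Some f. F (Some x) \<noteq> F q"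
    if "q \<noteq> Some x" for x q
  proof -
    \<comment> \<open>The limit 0 is the value of the extension at \<open>None\<close>, so
      \<open>Some x\<close> is separated from \<open>None\<close> as well.\<close>
    have "((indicator {x} :: 'x \<Rightarrow> real) \<longlongrightarrow> 0) cofinite"
      by (rule tendsto_eventually) (auto simp: eventually_cofinite indicator_def)
    from ex[OF this] show ?thesis
      by (intro bexI[OF _ ind[of x]] bexI[of _ "case_option 0 (indicator {x})"])
         (use that in \<open>auto simp: indicator_def split: option.splits\<close>)
  qed
  have sep: "\<exists>f \<in> royden_algebra b. \<exists>F \<in> continuous_extensions ?A Some f. F p \<noteq> F q" if "p \<noteq> q" for p q
    using sep_Some[of q] sep_Some[of p] that by (cases p; cases q) metis+
  show ?thesis
    unfolding royden_compactification_def
  proof (intro conjI ballI impI)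
    show "openin ?A (range Some)" by simp
    show "\<exists>!F. F \<in> continuous_extensions ?A Some f" if "f \<in> royden_algebra b" for f
      using lim[OF that] ex uniq by blast
  qed (use dense sep in \<open>auto simp: embedding_map_Some Hausdorff_space_Alexandroff_discrete\<close>)
qed

text \<open>A point outside the vertex set is approached by vertices, and deleting finitely many of
  them does not change this in a T1 space. On the remaining ones \<open>f\<close> is close to
  \<open>L\<close>.\<close>

lemma extension_eq_cofinite_limit:
  assumes R: "t1_space R" and dense: "R closure_of range \<iota> = topspace R"
    and ran: "range \<iota> \<subseteq> topspace R"
    and F: "continuous_map R euclideanreal F" "\<And>x. F (\<iota> x) = f x"
    and p: "p \<in> topspace R" "p \<notin> range \<iota>" and lim: "(f \<longlongrightarrow> L) cofinite"
  shows "F p = L"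
proof (rule ccontr)
  assume "F p \<noteq> L"
  then obtain U V where UV: "open U" "open V" "F p \<in> U" "L \<in> V" "U \<inter> V = {}"
    by (metis hausdorff)
  have fin: "finite {x. f x \<notin> V}"
    using lim UV topological_tendstoD eventually_cofinite by metis
  \<comment> \<open>This is a neighbourhood of \<open>p\<close> without any vertex: \<open>f\<close>
    lies in \<open>V\<close> at the vertices not removed, and \<open>V\<close> is disjoint from
    \<open>U\<close>. Density forbids this.\<close>
  let ?W = "{z \<in> topspace R. F z \<in> U} - \<iota> ` {x. f x \<notin> V}"
  have "openin R ?W"
  proof (rule openin_diff)
    show "openin R {z \<in> topspace R. F z \<in> U}"
      using F(1) UV(1) by (simp add: continuous_map_def)
    show "closedin R (\<iota> ` {x. f x \<notin> V})"
      using R fin ran unfolding t1_space_closedin_finite by blast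
  qed
  moreover have "p \<in> ?W" using p UV by auto
  moreover have "p \<in> R closure_of range \<iota>" using p dense by simp
  ultimately obtain q where "q \<in> range \<iota>" "q \<in> ?W"
    unfolding in_closure_of by meson
  then obtain x where "\<iota> x \<in> ?W" by auto
  then show False
    using F(2) UV by auto
qed

lemma royden_compactification_homeomorphic_Alexandroff:
  fixes b :: "'x \<Rightarrow> 'x \<Rightarrow> real"
  assumes inf: "infinite (UNIV :: 'x set)"
    and lim: "\<And>f. f \<in> royden_algebra b \<Longrightarrow> \<exists>L. (f \<longlongrightarrow> L) cofinite"
    and R: "royden_compactification b R \<iota>"
  shows "\<exists>h. homeomorphic_map R (Alexandroff_compactification (discrete_topology UNIV)) h \<and>
             (\<forall>x. h (\<iota> x) = Some x)"
proof -
  let ?A = "Alexandroff_compactification (discrete_topology (UNIV :: 'x set))"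
  have comp: "compact_space R" and haus: "Hausdorff_space R"
    and emb: "embedding_map (discrete_topology UNIV) R \<iota>"
    and ope: "openin R (range \<iota>)" and dense: "R closure_of range \<iota> = topspace R"
    and sep: "\<And>p q. \<lbrakk>p \<in> topspace R; q \<in> topspace R; p \<noteq> q\<rbrakk> \<Longrightarrow>
        \<exists>f \<in> royden_algebra b. \<exists>F \<in> continuous_extensions R \<iota> f. F p \<noteq> F q"
    using R unfolding royden_compactification_def by auto
  have inj: "inj \<iota>"
    using emb by (auto simp: embedding_map_def homeomorphic_map_def dest: homeomorphic_imp_injective_map)
  have t1: "t1_space R"
    using haus Hausdorff_imp_t1_space by blast
  have ran: "range \<iota> \<subseteq> topspace R"
    using ope openin_subset by blast
  \<comment> \<open>Vertices remain isolated in \<open>R\<close>, so every set of vertices is open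
    there.\<close>
  have omap: "open_map (discrete_topology UNIV) R \<iota>"
    using emb ope by (metis embedding_map_def homeomorphic_imp_open_map open_map_from_open_subtopology topspace_discrete_topology)
  have unique: "p = q" if pq: "p \<in> topspace R - range \<iota>" "q \<in> topspace R - range \<iota>" for p q
  proof (rule ccontr)
    assume "p \<noteq> q"
    then obtain f F where f: "f \<in> royden_algebra b" "F \<in> continuous_extensions R \<iota> f" "F p \<noteq> F q"
      using sep[of p q] pq by blast
    obtain L where "(f \<longlongrightarrow> L) cofinite" using lim f by blast
    then have "F p = L" "F q = L"
      using extension_eq_cofinite_limit[OF t1 dense ran, of F f _ L] pq f(2)
      by (auto simp: continuous_extensions_def)
    with f show False by simp
  qed
  have "topspace R \<noteq> range \<iota>"
  proof
    assume "topspace R = range \<iota>"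
    then have "discrete_topology (UNIV :: 'x set) homeomorphic_space R"
      using embedding_map_imp_homeomorphic_space[OF emb] by (metis subtopology_topspace topspace_discrete_topology)
    then have "compact_space (discrete_topology (UNIV :: 'x set))"
      using comp homeomorphic_compact_space by blast
    with inf show False by (simp add: compact_space_discrete_topology)
  qed
  then obtain \<omega> where \<omega>: "\<omega> \<in> topspace R" "\<omega> \<notin> range \<iota>"
    using ran by blast
  then have top: "topspace R = insert \<omega> (range \<iota>)"
    using unique ran by auto
  define h where "h p = (if p \<in> range \<iota> then Some (inv \<iota> p) else None)" for p
  have h\<iota>: "h (\<iota> x) = Some x" for x
    using inj by (simp add: h_def)
  have h\<omega>: "h \<omega> = None"
    using \<omega> by (simp add: h_def)
  have "homeomorphic_map R ?A h"
  \<comment> \<open>A continuous bijection from a compact space onto a Hausdorff space has a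
    continuous inverse.\<close>
  proof (rule continuous_imp_homeomorphic_map)
    show "h ` topspace R = topspace ?A"
      unfolding top by (auto simp: h\<iota> h\<omega> image_iff)
    show "inj_on h (topspace R)"
      unfolding top by (auto simp: inj_on_def h\<iota> h\<omega>)
    show "continuous_map R ?A h"
      unfolding continuous_map_def
    proof (intro conjI strip)
      fix V assume "openin ?A V"
      then consider U where "V = Some ` U" | C where "finite C" "V = insert None (Some ` (UNIV - C))"
        unfolding openin_Alexandroff_compactification by (auto simp: compactin_discrete_topology)
      then show "openin R {p \<in> topspace R. h p \<in> V}"
      proof cases
        case 1
        then have "{p \<in> topspace R. h p \<in> V} = \<iota> ` U"
          unfolding top by (auto simp: h\<iota> h\<omega>)
        then show ?thesis
          using omap by (simp add: open_map_def)
      next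
        case 2
        then have "{p \<in> topspace R. h p \<in> V} = topspace R - \<iota> ` C"
          unfolding top using \<omega> by (auto simp: h\<iota> h\<omega> dest: injD[OF inj])
        moreover have "closedin R (\<iota> ` C)"
          using t1 2 ran unfolding t1_space_closedin_finite by blast
        ultimately show ?thesis by auto
      qed
    next
      show "h \<in> topspace R \<rightarrow> topspace ?A"
        unfolding top by (auto simp: h\<iota> h\<omega>)
    qed
  qed (use comp in \<open>auto simp: Hausdorff_space_Alexandroff_discrete\<close>)
  with h\<iota> show ?thesis by blast
qed

subsection \<open>Finite energy on the lattice\<close>

lemma sum_le_infsum_ennreal:
  fixes g :: "'a \<Rightarrow> ennreal"
  assumes "finite S"
  shows "sum g S \<le> infsum g UNIV"
  unfolding nonneg_infsum_complete[of UNIV g, simplified]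
  by (rule SUP_upper) (use assms in auto)

lemma dist_lattice_point_axis:
  "dist (lattice_point (x + axis i 1)) (lattice_point x) = 1"
proof -
  have "lattice_point (x + axis i 1) - lattice_point x = axis i (1::real)"
    by (simp add: lattice_point_def vec_eq_iff axis_def)
  then show ?thesis by (simp add: dist_norm)
qed

lemma standard_weights_axis: "standard_weights (x + axis i 1) x = 1"
  by (simp add: standard_weights_def dist_lattice_point_axis)

text \<open>The pairs \<open>(z + axis i 1, z)\<close> are distinct edges of weight 1. Hence the
  whole double sum, without the factor 1/2, serves as one constant \<open>K\<close> for all
  directions \<open>i\<close> and all \<open>S\<close>.\<close>

lemma finite_energy_bound:
  fixes f :: "int ^ 'd \<Rightarrow> real"
  assumes "f \<in> finite_energy standard_weights"
  obtains K where "K \<ge> 0"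
    "\<And>i S. finite S \<Longrightarrow> (\<Sum>z\<in>S. (f (z + axis i 1) - f z)\<^sup>2) \<le> K"
proof -
  define g where "g = (\<lambda>(x, y). ennreal (standard_weights x y * \<bar>f x - f y\<bar>\<^sup>2))"
  have "infsum g UNIV < \<infinity>"
  proof (rule ccontr)
    assume "\<not> infsum g UNIV < \<infinity>"
    then have "infsum g UNIV = \<infinity>"
      by (metis infinity_ennreal_def less_top)
    then have "energy standard_weights f = \<infinity>"
      by (simp add: energy_def g_def ennreal_mult_top)
    with assms show False
      by (simp add: finite_energy_def)
  qed
  then obtain K where K: "K \<ge> 0" "infsum g UNIV = ennreal K"
    by (cases "infsum g UNIV") auto
  have "(\<Sum>z\<in>S. (f (z + axis i 1) - f z)\<^sup>2) \<le> K" if "finite S" for i S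
  proof -
    have "ennreal (\<Sum>z\<in>S. (f (z + axis i 1) - f z)\<^sup>2) = (\<Sum>z\<in>S. g (z + axis i 1, z))"
      by (simp add: g_def standard_weights_axis)
    also have "\<dots> = sum g ((\<lambda>z. (z + axis i 1, z)) ` S)"
      by (subst sum.reindex) (auto simp: inj_on_def)
    also have "\<dots> \<le> ennreal K"
      using sum_le_infsum_ennreal[of _ g] that K by simp
    finally show ?thesis
      using K by simp
  qed
  with K that show ?thesis by blast
qed

lemma finite_int_vec_box:
  fixes l u :: "'d::finite \<Rightarrow> int"
  shows "finite {v :: int ^ 'd. \<forall>i. l i \<le> v $ i \<and> v $ i \<le> u i}"
proof -
  have "{v :: int ^ 'd. \<forall>i. l i \<le> v $ i \<and> v $ i \<le> u i} \<subseteq> vec_lambda ` (\<Pi>\<^sub>E i\<in>UNIV. {l i..u i})"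
  proof
    fix v :: "int ^ 'd"
    assume "v \<in> {v. \<forall>i. l i \<le> v $ i \<and> v $ i \<le> u i}"
    then have "vec_nth v \<in> (\<Pi>\<^sub>E i\<in>UNIV. {l i..u i})" by auto
    then show "v \<in> vec_lambda ` (\<Pi>\<^sub>E i\<in>UNIV. {l i..u i})"
      by (rule image_eqI[rotated]) simp
  qed
  then show ?thesis
    by (rule finite_subset) (intro finite_imageI finite_PiE; simp)
qed

lemma finite_neighbours:
  fixes x :: "int ^ 'd"
  shows "finite {y. standard_weights x y \<noteq> 0}"
proof (rule finite_subset)
  show "{y. standard_weights x y \<noteq> 0} \<subseteq> {y. \<forall>i. x $ i - 1 \<le> y $ i \<and> y $ i \<le> x $ i + 1}"
  proof (safe)
    fix y i
    assume "standard_weights x y \<noteq> 0"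
    then have "norm (lattice_point x - lattice_point y) = 1"
      by (auto simp: standard_weights_def dist_norm split: if_splits)
    then have "\<bar>(lattice_point x - lattice_point y) $ i\<bar> \<le> 1"
      using component_le_norm_cart by metis
    then have "\<bar>real_of_int (x $ i - y $ i)\<bar> \<le> 1"
      by (simp add: lattice_point_def)
    then have "\<bar>x $ i - y $ i\<bar> \<le> 1" by linarith
    then show "x $ i - 1 \<le> y $ i" "y $ i \<le> x $ i + 1" by auto
  qed
qed (rule finite_int_vec_box)

lemma standard_weights_sym: "standard_weights x y = standard_weights y x"
  by (simp add: standard_weights_def dist_commute)

text \<open>Only the edges at \<open>x\<close> contribute to the energy, and there are finitely many
  of them.\<close>

lemma indicator_in_royden_algebra:
  fixes x :: "int ^ 'd"
  shows "indicator {x} \<in> royden_algebra standard_weights"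
proof -
  let ?f = "indicator {x} :: int ^ 'd \<Rightarrow> real"
  define g where "g = (\<lambda>(y, z). ennreal (standard_weights y z * \<bar>?f y - ?f z\<bar>\<^sup>2))"
  let ?N = "{y. standard_weights x y \<noteq> 0}"
  let ?S = "{x} \<times> ?N \<union> ?N \<times> {x}"
  have fin: "finite ?S" using finite_neighbours by auto
  have "infsum g UNIV = infsum g ?S"
  proof (rule infsum_cong_neutral)
    fix p assume "p \<in> UNIV - ?S"
    moreover obtain y z where "p = (y, z)" by fastforce
    moreover have "standard_weights y x = standard_weights x y"
      by (rule standard_weights_sym)
    ultimately show "g p = 0"
      by (cases "y = x"; cases "z = x") (auto simp: g_def)
  qed auto
  also have "\<dots> = sum g ?S" using fin by simp
  also have "\<dots> < \<infinity>" using fin by (auto simp: g_def)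
  finally have "infsum g UNIV < top" by simp
  moreover have "(1 / 2 :: ennreal) < top"
    by (simp add: less_top[symmetric] ennreal_divide_eq_top_iff)
  ultimately have "energy standard_weights ?f < \<infinity>"
    unfolding energy_def g_def infinity_ennreal_def by (rule ennreal_mult_less_top[THEN iffD2, OF disjI2, OF disjI2, OF conjI, rotated])
  moreover have "range ?f \<subseteq> {0, 1}" by (auto simp: indicator_def)
  then have "bounded (range ?f)" by (meson bounded_subset finite.intros finite_imp_bounded)
  ultimately show ?thesis
    by (simp add: royden_algebra_def finite_energy_def)
qed

text \<open>Each point with difference at least \<open>e\<close> contributes at least
  \<open>e^2\<close> to the square sum, so there are at most \<open>K / e^2\<close> such
  points.\<close>

lemma gradient_tendsto_0:
  fixes f :: "int ^ 'd \<Rightarrow> real"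
  assumes "\<And>S. finite S \<Longrightarrow> (\<Sum>z\<in>S. (f (z + axis i 1) - f z)\<^sup>2) \<le> K"
  shows "((\<lambda>z. f (z + axis i 1) - f z) \<longlongrightarrow> 0) cofinite"
proof (rule tendstoI)
  fix e :: real
  assume "e > 0"
  let ?T = "{z. \<not> dist (f (z + axis i 1) - f z) 0 < e}"
  have "finite ?T"
  proof (rule ccontr)
    assume "infinite ?T"
    then obtain S where S: "S \<subseteq> ?T" "finite S" "card S = Suc (nat \<lceil>K / e\<^sup>2\<rceil>)"
      using infinite_arbitrarily_large by blast
    have "real (card S) * e\<^sup>2 \<le> (\<Sum>z\<in>S. (f (z + axis i 1) - f z)\<^sup>2)"
      using S \<open>e > 0\<close> by (intro sum_bounded_below) (force simp: not_less intro: abs_le_square_iff[THEN iffD1])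
    also have "\<dots> \<le> K" using assms S by blast
    finally have "real (card S) \<le> K / e\<^sup>2"
      using \<open>e > 0\<close> by (simp add: field_simps)
    then show False using S by linarith
  qed
  then show "\<forall>\<^sub>F z in cofinite. dist (f (z + axis i 1) - f z) 0 < e"
    by (simp add: eventually_cofinite)
qed

subsection \<open>Means over cubes\<close>

text \<open>Induction on the coordinate sum: it follows a lattice path from 0 to \<open>v\<close>
  that stays in the nonnegative orthant.\<close>

lemma nonneg_int_vec_induct [consumes 1, case_names zero step]:
  fixes v :: "int ^ 'd"
  assumes "\<And>i. 0 \<le> v $ i"
    and zero: "P 0"
    and step: "\<And>v i. (\<And>j. 0 \<le> v $ j) \<Longrightarrow> P v \<Longrightarrow> P (v + axis i 1)"
  shows "P v"
  using assms(1)
proof (induction "nat (\<Sum>i\<in>UNIV. v $ i)" arbitrary: v)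
  case 0
  then have "(\<Sum>i\<in>UNIV. v $ i) = 0"
    by (simp add: sum_nonneg antisym)
  then have "v = 0"
    using 0(2) by (simp add: sum_nonneg_eq_0_iff vec_eq_iff)
  with zero show ?case by simp
next
  case (Suc n)
  have "v \<noteq> 0" using Suc(2) by auto
  then obtain i where "v $ i \<noteq> 0" by (auto simp: vec_eq_iff)
  then have i: "v $ i \<ge> 1" using Suc(3)[of i] by linarith
  define w where "w = v - axis i 1"
  have w: "0 \<le> w $ j" for j
    using i Suc(3)[of j] by (simp add: w_def axis_def)
  have "(\<Sum>i\<in>UNIV. w $ i) = (\<Sum>i\<in>UNIV. v $ i) - 1"
    by (simp add: w_def sum_subtractf axis_def)
  then have "n = nat (\<Sum>i\<in>UNIV. w $ i)"
    using Suc(2) by linarith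
  then have "P w" using Suc(1) w by blast
  then have "P (w + axis i 1)" using step w by blast
  then show ?case by (simp add: w_def)
qed

lemma shift_le_of_axis_shift_le:
  fixes g :: "int ^ 'd \<Rightarrow> real"
  assumes "\<And>x i. \<bar>g (x + axis i 1) - g x\<bar> \<le> c" and "\<And>i. 0 \<le> v $ i"
  shows "\<bar>g (x + v) - g x\<bar> \<le> c * of_int (\<Sum>i\<in>UNIV. v $ i)"
  using assms(2)
proof (induction v rule: nonneg_int_vec_induct)
  case zero
  show ?case by simp
next
  case (step v i)
  have "(\<Sum>j\<in>UNIV. (v + axis i 1) $ j) = (\<Sum>j\<in>UNIV. v $ j) + 1"
    by (simp add: sum.distrib axis_def)
  then show ?case
    using step(2) assms(1)[of "x + v" i] by (simp add: algebra_simps abs_le_iff)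
qed

text \<open>A shift by \<open>v\<close> telescopes into finitely many unit steps, each taken at a
  translate of \<open>z\<close>.\<close>

lemma shift_tendsto_0:
  fixes f :: "int ^ 'd \<Rightarrow> real"
  assumes "\<And>i. ((\<lambda>z. f (z + axis i 1) - f z) \<longlongrightarrow> 0) cofinite" and "\<And>i. 0 \<le> v $ i"
  shows "((\<lambda>z. f (z + v) - f z) \<longlongrightarrow> 0) cofinite"
  using assms(2)
proof (induction v rule: nonneg_int_vec_induct)
  case zero
  show ?case by simp
next
  case (step v i)
  \<comment> \<open>Translations are injective, so preimages of finite sets are finite.\<close>
  have "filterlim (\<lambda>z. z + v) cofinite cofinite"
    unfolding filterlim_iff eventually_cofinite
  proof (intro allI impI)
    fix P :: "int ^ 'd \<Rightarrow> bool"
    assume "finite {x. \<not> P x}"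
    then have "finite ((\<lambda>z. z + v) -` {x. \<not> P x})"
      by (rule finite_vimageI) (simp add: inj_on_def)
    then show "finite {x. \<not> P (x + v)}" by (simp add: vimage_def)
  qed
  from filterlim_compose[OF assms(1) this]
  have "((\<lambda>z. f (z + v + axis i 1) - f (z + v)) \<longlongrightarrow> 0) cofinite" .
  from tendsto_add[OF this step(2)] show ?case
    by (simp add: add.assoc)
qed

text \<open>Half-open and anchored at the corner 0: it has exactly \<open>n ^ CARD('d)\<close>
  points, and only nonnegative shifts occur, as the shift lemmas require.\<close>

definition cube :: "nat \<Rightarrow> (int ^ 'd) set" where
  "cube n = {v. \<forall>i. 0 \<le> v $ i \<and> v $ i < int n}"

definition cube_mean :: "(int ^ 'd \<Rightarrow> real) \<Rightarrow> nat \<Rightarrow> int ^ 'd \<Rightarrow> real" where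
  "cube_mean f n x = (\<Sum>v\<in>cube n. f (x + v)) / real n ^ CARD('d)"

lemma cube_eq_image: "(cube n :: (int ^ 'd) set) = vec_lambda ` (\<Pi>\<^sub>E i\<in>UNIV. {0..<int n})"
proof -
  have "v \<in> vec_lambda ` (\<Pi>\<^sub>E i\<in>UNIV. {0..<int n})" if "v \<in> cube n" for v :: "int ^ 'd"
    by (rule image_eqI[of _ _ "vec_nth v"]) (use that in \<open>auto simp: cube_def\<close>)
  then show ?thesis by (auto simp: cube_def PiE_iff)
qed

lemma finite_cube [simp]: "finite (cube n)"
  unfolding cube_eq_image by (intro finite_imageI finite_PiE) auto

lemma card_cube: "card (cube n :: (int ^ 'd) set) = n ^ CARD('d)"
proof -
  have "inj_on vec_lambda (\<Pi>\<^sub>E i\<in>(UNIV :: 'd set). {0..<int n})"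
    by (metis inj_onI vec_lambda_inverse UNIV_I)
  then show ?thesis
    by (simp add: cube_eq_image card_image card_PiE)
qed

lemma cube_sum_le:
  assumes "v \<in> (cube n :: (int ^ 'd) set)"
  shows "(\<Sum>i\<in>UNIV. v $ i) \<le> int CARD('d) * int n"
  using sum_bounded_above[of "UNIV :: 'd set" "\<lambda>i. v $ i" "int n"] assms
  by (force simp: cube_def intro: less_imp_le)

lemma abs_mean_le:
  fixes g :: "int ^ 'd \<Rightarrow> real"
  assumes "n > 0" and "\<And>v. v \<in> cube n \<Longrightarrow> \<bar>g v\<bar> \<le> c"
  shows "\<bar>(\<Sum>v\<in>cube n. g v) / real n ^ CARD('d)\<bar> \<le> c"
proof -
  have "\<bar>\<Sum>v\<in>cube n. g v\<bar> \<le> (\<Sum>v\<in>cube n. \<bar>g v\<bar>)" by (rule sum_abs)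
  also have "\<dots> \<le> real n ^ CARD('d) * c"
    using sum_bounded_above[of "cube n" "\<lambda>v. \<bar>g v\<bar>" c] assms(2) by (simp add: card_cube)
  finally show ?thesis
    using assms(1) by (simp add: field_simps)
qed

text \<open>The difference is the mean of \<open>n ^ CARD('d)\<close> gradient values. By
  Cauchy-Schwarz the square of their sum is at most the number of terms times \<open>K\<close>, and
  the mean divides by the square of that number.\<close>

lemma cube_mean_axis_shift:
  fixes f :: "int ^ 'd \<Rightarrow> real"
  assumes K: "\<And>S. finite S \<Longrightarrow> (\<Sum>z\<in>S. (f (z + axis i 1) - f z)\<^sup>2) \<le> K"
    and n: "n > 0"
  shows "(cube_mean f n (x + axis i 1) - cube_mean f n x)\<^sup>2 \<le> K / real n ^ CARD('d)"
proof -
  let ?N = "real n ^ CARD('d)"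
  let ?g = "\<lambda>v. f (x + v + axis i 1) - f (x + v)"
  have eq: "cube_mean f n (x + axis i 1) - cube_mean f n x = (\<Sum>v\<in>cube n. ?g v) / ?N"
    by (simp add: cube_mean_def sum_subtractf diff_divide_distrib algebra_simps)
  have "(\<Sum>v\<in>cube n. ?g v)\<^sup>2 \<le> (\<Sum>v\<in>cube n. (?g v)\<^sup>2) * ?N"
    using sum_squared_le_sum_of_squares[of ?g "cube n"] by (simp add: card_cube)
  also have "(\<Sum>v\<in>cube n. (?g v)\<^sup>2) = (\<Sum>z\<in>(+) x ` cube n. (f (z + axis i 1) - f z)\<^sup>2)"
    by (subst sum.reindex) auto
  also have "\<dots> * ?N \<le> K * ?N"
    by (intro mult_right_mono K) auto
  finally have "(\<Sum>v\<in>cube n. ?g v)\<^sup>2 / ?N\<^sup>2 \<le> K * ?N / ?N\<^sup>2"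
    by (rule divide_right_mono) simp
  then show ?thesis
    unfolding eq power_divide using n by (simp add: power2_eq_square)
qed

text \<open>Both sides are normalised versions of the same double sum; this iterated mean links the
  two side lengths.\<close>

lemma cube_mean_cube_mean_commute:
  "cube_mean (cube_mean f n) m x = cube_mean (cube_mean f m) n x"
proof -
  have "(\<Sum>w\<in>cube m. \<Sum>v\<in>cube n. f (x + w + v)) = (\<Sum>v\<in>cube n. \<Sum>w\<in>cube m. f (x + v + w))"
    by (subst sum.swap) (simp add: algebra_simps)
  then show ?thesis
    by (simp add: cube_mean_def sum_divide_distrib[symmetric] algebra_simps)
qed

lemma cube_mean_diff:
  fixes g :: "int ^ 'd \<Rightarrow> real"
  assumes "n > 0"
  shows "cube_mean g n x - g x = (\<Sum>v\<in>cube n. g (x + v) - g x) / real n ^ CARD('d)"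
  using assms by (simp add: cube_mean_def sum_subtractf card_cube field_simps)

text \<open>Every point of the cube is reached from its corner by at most
  \<open>CARD('d) * n\<close> unit steps, each changing \<open>g\<close> by at most
  \<open>c\<close>.\<close>

lemma abs_cube_mean_diff_le:
  fixes g :: "int ^ 'd \<Rightarrow> real"
  assumes c: "\<And>x i. \<bar>g (x + axis i 1) - g x\<bar> \<le> c" and "n > 0"
  shows "\<bar>cube_mean g n x - g x\<bar> \<le> c * (real CARD('d) * real n)"
  unfolding cube_mean_diff[OF assms(2)]
proof (rule abs_mean_le[OF assms(2)])
  fix v :: "int ^ 'd"
  assume v: "v \<in> cube n"
  have "c \<ge> 0" using c[of 0 undefined] by linarith
  have "\<bar>g (x + v) - g x\<bar> \<le> c * of_int (\<Sum>i\<in>UNIV. v $ i)"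
    by (rule shift_le_of_axis_shift_le[of g c v x, OF c]) (use v in \<open>auto simp: cube_def\<close>)
  also have "\<dots> \<le> c * of_int (int CARD('d) * int n)"
    using cube_sum_le[OF v] \<open>c \<ge> 0\<close> by (intro mult_left_mono) (simp_all only: of_int_le_iff)
  finally show "\<bar>g (x + v) - g x\<bar> \<le> c * (real CARD('d) * real n)" by simp
qed

lemma cube_mean_tendsto_0:
  fixes f :: "int ^ 'd \<Rightarrow> real"
  assumes "\<And>i. ((\<lambda>z. f (z + axis i 1) - f z) \<longlongrightarrow> 0) cofinite" and "n > 0"
  shows "((\<lambda>z. cube_mean f n z - f z) \<longlongrightarrow> 0) cofinite"
  unfolding cube_mean_diff[OF assms(2)]
proof (rule tendsto_divide_zero, rule tendsto_null_sum)
  fix v :: "int ^ 'd"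
  assume "v \<in> cube n"
  then show "((\<lambda>z. f (z + v) - f z) \<longlongrightarrow> 0) cofinite"
    by (intro shift_tendsto_0[of f v, OF assms(1)]) (simp add: cube_def)
qed

text \<open>
  With side lengths \<open>4 ^ n\<close> the decay \<open>N powr (- d / 2) \<le> N powr (- 3 / 2)\<close> of the axis differences
  of the means becomes the rational number \<open>8 ^ - n\<close>, which beats the side length.
\<close>

lemma cube_mean_axis_shift_pow4:
  fixes f :: "int ^ 'd \<Rightarrow> real"
  assumes d: "CARD('d) \<ge> 3" and "K \<ge> 0"
    and K: "\<And>i S. finite S \<Longrightarrow> (\<Sum>z\<in>S. (f (z + axis i 1) - f z)\<^sup>2) \<le> K"
  shows "\<bar>cube_mean f (4 ^ n) (x + axis i 1) - cube_mean f (4 ^ n) x\<bar> \<le> sqrt K / 8 ^ n"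
proof (rule power2_le_imp_le)
  \<comment> \<open>Here dimension at least 3 enters: the number of points of the cube is at least
    the square of \<open>8 ^ n\<close>.\<close>
  have "(8 ^ n)\<^sup>2 = (real (4 ^ n)) ^ 3"
    by (simp add: power_mult[symmetric] mult.commute[of n]) (simp add: power_mult)
  also have "\<dots> \<le> real (4 ^ n) ^ CARD('d)"
    by (rule power_increasing[OF d]) simp
  finally have "K / real (4 ^ n) ^ CARD('d) \<le> K / (8 ^ n)\<^sup>2"
    using \<open>K \<ge> 0\<close> by (intro divide_left_mono) auto
  moreover have "(cube_mean f (4 ^ n) (x + axis i 1) - cube_mean f (4 ^ n) x)\<^sup>2 \<le> K / real (4 ^ n) ^ CARD('d)"
    by (rule cube_mean_axis_shift[OF K]) auto
  ultimately show "\<bar>cube_mean f (4 ^ n) (x + axis i 1) - cube_mean f (4 ^ n) x\<bar>\<^sup>2 \<le> (sqrt K / 8 ^ n)\<^sup>2"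
    using \<open>K \<ge> 0\<close> by (simp add: power_divide)
qed (use \<open>K \<ge> 0\<close> in simp)

text \<open>Each of the two means is compared with the iterated mean \<open>?B\<close>. Averaging
  the finer mean over the larger cube costs \<open>4 * k * d / 2 ^ n\<close>, and averaging the
  coarser mean over the smaller cube costs \<open>k * d / (8 * 2 ^ n)\<close>, where
  \<open>d\<close> is the dimension.\<close>

lemma cube_mean_pow4_Suc:
  fixes f :: "int ^ 'd \<Rightarrow> real"
  assumes c: "\<And>n x i. \<bar>cube_mean f (4 ^ n) (x + axis i 1) - cube_mean f (4 ^ n) x\<bar> \<le> k / 8 ^ n"
  shows "\<bar>cube_mean f (4 ^ Suc n) x - cube_mean f (4 ^ n) x\<bar> \<le> 5 * k * CARD('d) / 2 ^ n"
proof -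
  let ?B = "cube_mean (cube_mean f (4 ^ n)) (4 ^ Suc n) x"
  have k: "k \<ge> 0" using c[of 0 0 undefined] by simp
  have p: "(8::real) ^ n = 4 ^ n * 2 ^ n"
    by (simp flip: power_mult_distrib)
  have "\<bar>?B - cube_mean f (4 ^ n) x\<bar> \<le> k / 8 ^ n * (CARD('d) * real (4 ^ Suc n))"
    by (rule abs_cube_mean_diff_le[of "cube_mean f (4 ^ n)" "k / 8 ^ n", OF c]) simp
  also have "\<dots> = 4 * k * CARD('d) / 2 ^ n"
    by (simp add: p field_simps)
  finally have 1: "\<bar>?B - cube_mean f (4 ^ n) x\<bar> \<le> 4 * k * CARD('d) / 2 ^ n" .
  have "\<bar>?B - cube_mean f (4 ^ Suc n) x\<bar> \<le> k / 8 ^ Suc n * (CARD('d) * real (4 ^ n))"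
    unfolding cube_mean_cube_mean_commute[of f "4 ^ n"]
    by (rule abs_cube_mean_diff_le[of "cube_mean f (4 ^ Suc n)" "k / 8 ^ Suc n", OF c]) simp
  also have "\<dots> = (k * CARD('d) / 2 ^ n) / 8"
    by (simp add: p field_simps)
  \<comment> \<open>Rounding 1/8 up to 1 gives the total constant 4 + 1 = 5.\<close>
  also have "\<dots> \<le> k * CARD('d) / 2 ^ n"
  proof -
    have "t / 8 \<le> t" if "t \<ge> 0" for t :: real
      using that by simp
    then show ?thesis using k by (meson divide_nonneg_nonneg mult_nonneg_nonneg of_nat_0_le_iff zero_le_numeral zero_le_power)
  qed
  finally have "\<bar>?B - cube_mean f (4 ^ Suc n) x\<bar> \<le> k * CARD('d) / 2 ^ n" .
  with 1 have "\<bar>cube_mean f (4 ^ Suc n) x - cube_mean f (4 ^ n) x\<bar>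
      \<le> 4 * k * CARD('d) / 2 ^ n + k * CARD('d) / 2 ^ n" by linarith
  then show ?thesis by (simp add: field_simps)
qed

section \<open>Convergence of the means and of the function at infinity\<close>

text \<open>The error is bounded by the geometric tail of the terms \<open>C / 2 ^ m\<close> with
  \<open>m \<ge> n\<close>, which sums to \<open>2 * C / 2 ^ n\<close>.\<close>

lemma geometric_Cauchy_limit:
  fixes a :: "nat \<Rightarrow> real"
  assumes "\<And>n. \<bar>a (Suc n) - a n\<bar> \<le> C / 2 ^ n"
  shows "\<exists>L. a \<longlonglongrightarrow> L \<and> (\<forall>n. \<bar>a n - L\<bar> \<le> 2 * C / 2 ^ n)"
proof -
  \<comment> \<open>The right-hand side is the exact finite geometric sum, which lets the induction
    on \<open>k\<close> close.\<close>
  have diff: "\<bar>a (n + k) - a n\<bar> \<le> 2 * C / 2 ^ n - 2 * C / 2 ^ (n + k)" for n k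
  proof (induction k)
    case (Suc k)
    have "2 * C / 2 ^ (n + Suc k) = C / 2 ^ (n + k)" "2 * C / 2 ^ (n + k) = C / 2 ^ (n + k) + C / 2 ^ (n + k)"
      by (simp_all add: field_simps)
    then show ?case
      using Suc assms[of "n + k"] by (simp add: abs_le_iff)
  qed simp
  have "summable (\<lambda>n. a (Suc n) - a n)"
  proof (rule summable_comparison_test')
    show "summable (\<lambda>n. C * (1 / 2) ^ n :: real)" by (intro summable_mult summable_geometric) simp
    show "norm (a (Suc n) - a n) \<le> C * (1 / 2) ^ n" for n
      using assms[of n] by (simp add: power_one_over)
  qed
  then obtain s where "(\<lambda>n. a n - a 0) \<longlonglongrightarrow> s"
    by (auto simp: summable_def sums_def sum_lessThan_telescope)
  from tendsto_add[OF this tendsto_const[of "a 0"]]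
  obtain L where L: "a \<longlonglongrightarrow> L" by auto
  have "C \<ge> 0" using assms[of 0] by simp
  have "\<bar>a n - L\<bar> \<le> 2 * C / 2 ^ n" for n
  proof (rule LIMSEQ_le_const2)
    show "(\<lambda>k. \<bar>a n - a (k + n)\<bar>) \<longlonglongrightarrow> \<bar>a n - L\<bar>"
      by (intro tendsto_intros LIMSEQ_ignore_initial_segment L)
    show "\<exists>N. \<forall>k\<ge>N. \<bar>a n - a (k + n)\<bar> \<le> 2 * C / 2 ^ n"
    proof (intro exI allI impI)
      fix k
      have "2 * C / 2 ^ (n + k) \<ge> 0" using \<open>C \<ge> 0\<close> by simp
      then show "\<bar>a n - a (k + n)\<bar> \<le> 2 * C / 2 ^ n"
        using diff[of n k] by (simp add: add.commute abs_minus_commute)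
    qed
  qed
  with L show ?thesis by blast
qed

text \<open>The distance from \<open>f z\<close> to \<open>L\<close> is split at
  \<open>A n z\<close>: one part is small uniformly in \<open>z\<close> for large \<open>n\<close>,
  the other tends to 0 at infinity for each fixed \<open>n\<close>.\<close>

lemma finite_energy_cofinite_limit:
  fixes f :: "int ^ 'd \<Rightarrow> real"
  assumes d: "CARD('d) \<ge> 3" and f: "f \<in> finite_energy standard_weights"
  shows "\<exists>L. (f \<longlongrightarrow> L) cofinite"
proof -
  obtain K where K0: "K \<ge> 0"
    and K: "\<And>i S. finite S \<Longrightarrow> (\<Sum>z\<in>S. (f (z + axis i 1) - f z)\<^sup>2) \<le> K"
    using finite_energy_bound[OF f] by blast
  define A where "A n x = cube_mean f (4 ^ n) x" for n x
  define C where "C = 5 * sqrt K * CARD('d)"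
  have ax: "\<bar>A n (x + axis i 1) - A n x\<bar> \<le> sqrt K / 8 ^ n" for n x i
    unfolding A_def by (rule cube_mean_axis_shift_pow4[of K f, OF d K0 K])
  have Suc: "\<bar>A (Suc n) x - A n x\<bar> \<le> C / 2 ^ n" for n x
    unfolding A_def C_def by (rule cube_mean_pow4_Suc[of f "sqrt K", OF ax[unfolded A_def]])
  have conv: "\<exists>M. (\<lambda>n. A n x) \<longlonglongrightarrow> M \<and> (\<forall>n. \<bar>A n x - M\<bar> \<le> 2 * C / 2 ^ n)" for x
    by (rule geometric_Cauchy_limit[of "\<lambda>n. A n x" C, OF Suc])
  then obtain L where L: "(\<lambda>n. A n 0) \<longlonglongrightarrow> L" by blast
  \<comment> \<open>For fixed \<open>v\<close> the path length is constant, while each step costs at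
    most \<open>sqrt K / 8 ^ n\<close>.\<close>
  have shift: "(\<lambda>n. A n (x + v) - A n x) \<longlonglongrightarrow> 0" if "\<And>i. 0 \<le> v $ i" for x v
  proof (rule Lim_null_comparison)
    let ?s = "sqrt K * of_int (\<Sum>i\<in>UNIV. v $ i)"
    show "\<forall>\<^sub>F n in sequentially. norm (A n (x + v) - A n x) \<le> ?s * (1 / 8) ^ n"
    proof (rule always_eventually, rule allI)
      show "norm (A n (x + v) - A n x) \<le> ?s * (1 / 8) ^ n" for n
        using shift_le_of_axis_shift_le[OF ax that, of n x] by (simp add: power_one_over field_simps)
    qed
    show "(\<lambda>n. ?s * (1 / 8) ^ n) \<longlonglongrightarrow> 0"
      by (intro tendsto_mult_right_zero LIMSEQ_power_zero) simp
  qed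
  have lim: "(\<lambda>n. A n x) \<longlonglongrightarrow> L" for x
  proof -
    \<comment> \<open>compare at a common upper bound of \<open>0\<close> and \<open>x\<close>, since shifts are controlled for nonnegative vectors\<close>
    define w where "w = (\<chi> i. max (x $ i) 0)"
    have "(\<lambda>n. A n (x + (w - x)) - A n x) \<longlonglongrightarrow> 0" "(\<lambda>n. A n (0 + w) - A n 0) \<longlonglongrightarrow> 0"
      by (rule shift; simp add: w_def)+
    from tendsto_add[OF tendsto_diff[OF this(2,1)] L] show ?thesis by simp
  qed
  \<comment> \<open>The limit supplied by \<open>conv\<close> could depend on \<open>x\<close>;
    uniqueness of limits identifies it with \<open>L\<close>, and the bound is free of
    \<open>x\<close>.\<close>
  have unif: "\<bar>A n x - L\<bar> \<le> 2 * C / 2 ^ n" for n x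
    using conv[of x] LIMSEQ_unique[OF lim[of x]] by blast
  have near: "((\<lambda>z. A n z - f z) \<longlongrightarrow> 0) cofinite" for n
    unfolding A_def by (intro cube_mean_tendsto_0 gradient_tendsto_0[OF K]) auto
  have "(f \<longlongrightarrow> L) cofinite"
  proof (rule tendstoI)
    fix e :: real
    assume e: "e > 0"
    \<comment> \<open>By uniformity \<open>n\<close> is fixed before \<open>z\<close> varies, so
      \<open>near\<close> applies to this single \<open>n\<close>.\<close>
    have "(\<lambda>n. 2 * C * (1 / 2) ^ n) \<longlonglongrightarrow> 0"
      by (intro tendsto_mult_right_zero LIMSEQ_power_zero) simp
    then have "\<forall>\<^sub>F n in sequentially. 2 * C * (1 / 2) ^ n < e / 2"
      using e by (intro order_tendstoD(2)) auto
    then obtain n where "2 * C * (1 / 2) ^ n < e / 2"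
      using eventually_happens'[OF sequentially_bot] by blast
    then have n: "2 * C / 2 ^ n < e / 2"
      unfolding power_one_over by (simp only: times_divide_eq_right mult_1_right)
    have "\<forall>\<^sub>F z in cofinite. dist (A n z - f z) 0 < e / 2"
      using near e by (intro tendstoD) auto
    then show "\<forall>\<^sub>F z in cofinite. dist (f z) L < e"
    proof eventually_elim
      case (elim z)
      then show ?case
        using unif[of n z] n unfolding dist_real_def by linarith
    qed
  qed
  then show ?thesis ..
qed

lemma infinite_int_vec: "infinite (UNIV :: (int ^ 'd) set)"
proof
  assume "finite (UNIV :: (int ^ 'd) set)"
  then have "finite (range (\<lambda>k. \<chi> i. k :: int ^ 'd))"
    by (rule finite_subset[rotated]) simp
  then have "finite (UNIV :: int set)"
    by (rule finite_imageD) (auto simp: inj_on_def vec_eq_iff)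
  then show False by simp
qed

text \<open>The first conjunct is existence; the second is uniqueness for a compactification
  \<open>R\<close> on an arbitrary type, by a homeomorphism that respects the embeddings of the
  lattice.\<close>

theorem mainTheorem7:
  fixes R :: "'r topology" and \<iota> :: "int ^ 'd \<Rightarrow> 'r"
  assumes "CARD('d) \<ge> 3"
  shows "royden_compactification (standard_weights :: int ^ 'd \<Rightarrow> int ^ 'd \<Rightarrow> real)
           (Alexandroff_compactification (discrete_topology UNIV)) Some \<and>
         (royden_compactification standard_weights R \<iota> \<longrightarrow>
           (\<exists>h. homeomorphic_map R (Alexandroff_compactification (discrete_topology UNIV)) h \<and>
                (\<forall>x. h (\<iota> x) = Some x)))"
proof -
  have lim: "\<exists>L. (f \<longlongrightarrow> L) cofinite" if "f \<in> royden_algebra standard_weights" for f :: "int ^ 'd \<Rightarrow> real"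
    using finite_energy_cofinite_limit[OF assms] that by (simp add: royden_algebra_def)
  show ?thesis
    using royden_compactification_Alexandroff[OF infinite_int_vec indicator_in_royden_algebra lim]
      royden_compactification_homeomorphic_Alexandroff[OF infinite_int_vec lim]
    by blast
qed

end
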